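(* Let $i,k,m$ be positive integers with $k\geqslant 2$ and $i\cdot\mathrm{rad}(i)\mid m$, and suppose $i=p_1^{\alpha_1}p_2^{\alpha_2}\cdots p_s^{\alpha_s}$ with $s\in\mathbb{N}_+$, distinct primes $p_1,\ldots,p_s$ and positive integers $\alpha_1,\ldots,\alpha_s$. Then \[ r_\mathcal{M}(i,m,k)=m\,\varphi^{k-2}(m)\prod_{j=1}^{s}\binom{\alpha_j+k-2}{\alpha_j}, \] where $\varphi$ is Euler's totient function and $\varphi^{k-2}(m)$ denotes $(\varphi(m))^{k-2}$.
   Context: $\mathbb{N}=\{0,1,2,\ldots\}$. For a positive integer $i$ with distinct prime divisors $p_1,\ldots,p_s$, $\mathrm{rad}(i)=p_1\cdots p_s$. Let $\mathcal{M}=(m^{j-1})_{j\in\mathbb{N}_+}$ and let $p_\mathcal{M}(n,k)$ be the number of tuples $(x_1,\ldots,x_k)\in\mathbb{N}^k$ with $x_1+mx_2+\cdots+m^{k-1}x_k=n$. For integers $k\ge1$ and $i$, define $r_\mathcal{M}(i,m,k)=\#\{n\in\{0,1,\ldots,m^k-1\}:\ p_\mathcal{M}(n,k)\equiv i\pmod{m}\}$. *)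

theory Defs
  imports "HOL-Number_Theory.Number_Theory" "HOL-Library.FuncSet"
begin

definition rad :: "nat \<Rightarrow> nat" where
  "rad i = \<Prod>(prime_factors i)"

definition power_seq :: "nat \<Rightarrow> nat \<Rightarrow> nat" where
  "power_seq m j = m ^ (j - 1)"

text \<open>Tuples in \<open>\<nat>\<^sup>k\<close> are extensional functions on \<open>{1..k}\<close>; sequences are indexed from 1.\<close>

definition part_count :: "(nat \<Rightarrow> nat) \<Rightarrow> nat \<Rightarrow> nat \<Rightarrow> nat" where
  "part_count a n k =
     card {x \<in> {1..k} \<rightarrow>\<^sub>E (UNIV :: nat set). (\<Sum>j = 1..k. a j * x j) = n}"

definition r_count :: "int \<Rightarrow> nat \<Rightarrow> nat \<Rightarrow> nat" where
  "r_count i m k =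
     card {n \<in> {0..<m ^ k}. [int (part_count (power_seq m) n k) = i] (mod int m)}"

end

theory Submission
  imports Defs
begin

text \<open>
  Grouping partitions by the number of parts equal to 1 gives
  \<open>p(n, k + 1) = \<Sum>l\<le>n div m. p(l, k)\<close>. Modulo \<open>m\<close> this makes \<open>p(n, k)\<close> congruent to the
  product of \<open>n\<^sub>j + 1\<close> over the base-\<open>m\<close> digits \<open>n\<^sub>1, \<dots>, n\<^bsub>k-1\<^esub>\<close> of \<open>n\<close>, the last digit
  \<open>n\<^sub>0\<close> being free. Hence \<open>r(i, m, k)\<close> is \<open>m\<close> times the number \<open>N(k - 1, i)\<close> of solutions of
  \<open>x\<^sub>1 \<cdots> x\<^bsub>k-1\<^esub> \<equiv> i\<close> modulo \<open>m\<close>.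

  For a given partial product \<open>y\<close>, the congruence \<open>x y \<equiv> z\<close> has \<open>gcd y m\<close> solutions if
  \<open>gcd y m\<close> divides \<open>z\<close> and none otherwise. So \<open>N(t, z)\<close> depends only on \<open>gcd z m\<close>, and
  \<open>N(t + 1, i)\<close> is the sum of \<open>d \<phi>(m / d) N(t, d)\<close> over the divisors \<open>d\<close> of \<open>i\<close>. The
  hypothesis \<open>i rad(i) dvd m\<close> gives \<open>d \<phi>(m / d) = \<phi>(m)\<close>, so \<open>N(t, i)\<close> is \<open>\<phi>(m)\<^bsup>t-1\<^esup>\<close> times the
  number of ordered factorisations of \<open>i\<close> into \<open>t\<close> factors, a product of binomial coefficients.
\<close>

section \<open>Restricted m-ary partitions modulo m\<close>

abbreviation part_set :: "nat \<Rightarrow> nat \<Rightarrow> nat \<Rightarrow> (nat \<Rightarrow> nat) set" where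
  "part_set m n k \<equiv>
     {x \<in> {1..k} \<rightarrow>\<^sub>E (UNIV :: nat set). (\<Sum>j = 1..k. power_seq m j * x j) = n}"

lemma sum_power_seq_Suc:
  "(\<Sum>j = 1..Suc k. power_seq m j * x j) = x 1 + m * (\<Sum>j = 1..k. power_seq m j * x (Suc j))"
proof -
  have "(\<Sum>j = 1..Suc k. power_seq m j * x j) = x 1 + (\<Sum>j = Suc 1..Suc k. power_seq m j * x j)"
    by (subst sum.atLeast_Suc_atMost) (auto simp: power_seq_def)
  also have "(\<Sum>j = Suc 1..Suc k. power_seq m j * x j)
      = (\<Sum>j = 1..k. power_seq m (Suc j) * x (Suc j))"
    by (rule sum.shift_bounds_cl_Suc_ivl)
  also have "\<dots> = m * (\<Sum>j = 1..k. power_seq m j * x (Suc j))"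
    unfolding sum_distrib_left
  proof (rule sum.cong)
    fix j assume "j \<in> {1..k}"
    then obtain j' where "j = Suc j'" by (cases j) auto
    then show "power_seq m (Suc j) * x (Suc j) = m * (power_seq m j * x (Suc j))"
      by (simp add: power_seq_def)
  qed simp
  finally show ?thesis .
qed

text \<open>Dropping the first entry and shifting the others down leaves a tuple of some value
  \<open>l\<close>, because all later weights are multiples of \<open>m\<close>. The lost entry is
  recovered as \<open>n - m * l\<close>, a genuine difference since
  \<open>l \<le> n div m\<close>.\<close>

lemma part_set_Suc_bij:
  assumes "m > 0"
  shows "bij_betw (\<lambda>(l, y). \<lambda>j\<in>{1..Suc k}. if j = 1 then n - m * l else y (j - 1))
           (SIGMA l:{..n div m}. part_set m l k) (part_set m n (Suc k))"
proof (rule bij_betw_byWitness[where f' =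
      "\<lambda>x. (\<Sum>j = 1..k. power_seq m j * x (Suc j), \<lambda>j\<in>{1..k}. x (Suc j))"], goal_cases)
  case 1
  show ?case
    by (auto simp: fun_eq_iff PiE_def extensional_def intro!: sum.cong)
next
  case 2
  show ?case
    unfolding sum_power_seq_Suc
    by (auto simp: fun_eq_iff PiE_def extensional_def Suc_le_eq)
next
  case 3
  have "m * l \<le> n" if "l \<le> n div m" for l
    using that assms by (metis less_eq_div_iff_mult_less_eq mult.commute)
  moreover have "(\<Sum>j = 1..k. power_seq m j * (\<lambda>j\<in>{1..Suc k}. if j = 1 then a else y (j - 1)) (Suc j))
      = (\<Sum>j = 1..k. power_seq m j * y j)" for a and y :: "nat \<Rightarrow> nat"
    by (intro sum.cong) auto
  ultimately show ?case
    unfolding sum_power_seq_Suc by auto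
next
  case 4
  have "(\<Sum>j = 1..k. power_seq m j * (\<lambda>j\<in>{1..k}. x (Suc j)) j)
      = (\<Sum>j = 1..k. power_seq m j * x (Suc j))" for x :: "nat \<Rightarrow> nat"
    by (intro sum.cong) auto
  then show ?case
    unfolding sum_power_seq_Suc using assms by auto
qed

lemma finite_part_set:
  assumes "m > 0"
  shows "finite (part_set m n k)"
proof (induction k arbitrary: n)
  case 0
  have "part_set m n 0 \<subseteq> {\<lambda>_. undefined}" by auto
  then show ?case by (rule finite_subset) simp
next
  case (Suc k)
  then have "finite (SIGMA l:{..n div m}. part_set m l k)" by (intro finite_SigmaI) auto
  then show ?case using bij_betw_finite[OF part_set_Suc_bij[OF assms, of n k]] by blast
qed

lemma part_count_0: "part_count a n 0 = (if n = 0 then 1 else 0)"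
proof -
  have "{x \<in> {1..0} \<rightarrow>\<^sub>E (UNIV :: nat set). (\<Sum>j = 1..0. a j * x j) = n}
      = (if n = 0 then {\<lambda>_. undefined} else {})"
    by auto
  then show ?thesis unfolding part_count_def by simp
qed

lemma part_count_Suc:
  assumes "m > 0"
  shows "part_count (power_seq m) n (Suc k) = (\<Sum>l\<le>n div m. part_count (power_seq m) l k)"
proof -
  have "part_count (power_seq m) n (Suc k) = card (SIGMA l:{..n div m}. part_set m l k)"
    unfolding part_count_def by (rule bij_betw_same_card[OF part_set_Suc_bij[OF assms], symmetric])
  also have "\<dots> = (\<Sum>l\<le>n div m. part_count (power_seq m) l k)"
    unfolding part_count_def using finite_part_set[OF assms] by (intro card_SigmaI) auto
  finally show ?thesis .
qed

lemma part_count_1: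
  assumes "m > 0"
  shows "part_count (power_seq m) n (Suc 0) = 1"
  by (simp add: part_count_Suc[OF assms] part_count_0)

lemma sum_atMost_div:
  fixes f :: "nat \<Rightarrow> nat"
  assumes "m > 0"
  shows "(\<Sum>l\<le>q. f (l div m)) = m * (\<Sum>l<q div m. f l) + (q mod m + 1) * f (q div m)"
proof (induction q)
  case 0
  then show ?case by simp
next
  case (Suc q)
  then show ?case
    by (cases "Suc (q mod m) = m") (auto simp: div_Suc mod_Suc algebra_simps)
qed

text \<open>The count of partitions of \<open>l\<close> depends only on \<open>l div m\<close>, so the sum in
  \<open>part_count_Suc\<close> consists of full blocks of \<open>m\<close> equal terms and one
  incomplete block of \<open>q mod m + 1\<close> terms.\<close>

lemma part_count_Suc_Suc_cong:
  assumes "m > 0"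
  shows "[part_count (power_seq m) n (Suc (Suc k))
          = (n div m mod m + 1) * part_count (power_seq m) (n div m) (Suc k)] (mod m)"
proof -
  define f where "f = (\<lambda>q. \<Sum>l\<le>q. part_count (power_seq m) l k)"
  have f: "part_count (power_seq m) l (Suc k) = f (l div m)" for l
    unfolding f_def by (rule part_count_Suc[OF assms])
  have "part_count (power_seq m) n (Suc (Suc k)) = (\<Sum>l\<le>n div m. f (l div m))"
    by (simp add: part_count_Suc[OF assms, of n "Suc k"] f)
  then show ?thesis
    by (simp add: sum_atMost_div[OF assms] f cong_def)
qed

fun digit_prod :: "nat \<Rightarrow> nat \<Rightarrow> nat \<Rightarrow> nat" where
  "digit_prod m 0 n = 1"
| "digit_prod m (Suc t) n = (n mod m + 1) * digit_prod m t (n div m)"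

lemma part_count_cong_digit_prod:
  assumes "m > 0"
  shows "[part_count (power_seq m) n (Suc t) = digit_prod m t (n div m)] (mod m)"
proof (induction t arbitrary: n)
  case 0
  then show ?case by (simp add: part_count_1[OF assms])
next
  case (Suc t)
  show ?case
    using cong_trans[OF part_count_Suc_Suc_cong[OF assms]
        cong_mult[OF cong_refl Suc.IH[of "n div m"]]] by simp
qed

section \<open>Counting solutions of multiplicative congruences\<close>

text \<open>Division with remainder by \<open>m\<close> separates the last digit from the rest. This
  serves both to peel off base-\<open>m\<close> digits and to count a residue class.\<close>

lemma card_less_mult_mod_div:
  fixes m N :: nat
  assumes "m > 0"
  shows "card {n. n < m * N \<and> Q (n mod m) (n div m)} = (\<Sum>b<N. card {a. a < m \<and> Q a b})"
proof -
  have less: "m * b + a < N * m" if "a < m" "b < N" for a b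
  proof -
    have "m * b + a < m * Suc b" using that by simp
    also have "\<dots> \<le> m * N" using that by (intro mult_le_mono2) simp
    finally show ?thesis by (simp only: mult.commute)
  qed
  have "bij_betw (\<lambda>(b, a). m * b + a) (SIGMA b:{..<N}. {a. a < m \<and> Q a b})
          {n. n < m * N \<and> Q (n mod m) (n div m)}"
    by (rule bij_betw_byWitness[where f' = "\<lambda>n. (n div m, n mod m)"])
      (use assms in \<open>auto simp: less less_mult_imp_div_less mult.commute[of m N]\<close>)
  then have "card {n. n < m * N \<and> Q (n mod m) (n div m)}
      = card (SIGMA b:{..<N}. {a. a < m \<and> Q a b})"
    by (simp add: bij_betw_same_card)
  then show ?thesis by simp
qed

lemma card_less_mult_cong:
  fixes b g m :: nat
  assumes "m > 0"
  shows "card {a. a < m * g \<and> [a = b] (mod m)} = g"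
proof -
  have "card {a. a < m * g \<and> [a = b] (mod m)} = (\<Sum>c<g. card {a. a < m \<and> a = b mod m})"
    unfolding cong_def by (rule card_less_mult_mod_div[OF assms])
  also have "{a. a < m \<and> a = b mod m} = {b mod m}" using assms by auto
  finally show ?thesis by simp
qed

text \<open>Dividing by the gcd leaves an invertible coefficient, so \<open>a\<close> is fixed
  modulo \<open>m div gcd y m\<close>, in a class with \<open>gcd y m\<close> members below
  \<open>m\<close>. The shift \<open>c\<close> will be 1, as each digit enters the product increased
  by 1.\<close>

lemma card_linear_cong:
  fixes c m y z :: nat
  assumes "m > 0"
  shows "card {a. a < m \<and> [(a + c) * y = z] (mod m)} = (if gcd y m dvd z then gcd y m else 0)"
proof (cases "gcd y m dvd z")
  case False
  have "\<not> [(a + c) * y = z] (mod m)" for a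
  proof
    assume "[(a + c) * y = z] (mod m)"
    then have "[(a + c) * y = z] (mod gcd y m)" by (rule cong_dvd_modulus_nat) simp
    then have "gcd y m dvd (a + c) * y \<longleftrightarrow> gcd y m dvd z" by (rule cong_dvd_iff)
    then have "gcd y m dvd z" by simp
    with False show False by simp
  qed
  with False show ?thesis by simp
next
  case True
  define g where "g = gcd y m"
  have "g > 0" using assms by (simp add: g_def)
  obtain y' m' where y': "y = y' * g" and m': "m = m' * g" and cop: "coprime y' m'"
    using gcd_coprime_exists[of y m] \<open>g > 0\<close> unfolding g_def by auto
  obtain z' where z': "z = z' * g" using True unfolding g_def by (metis dvd_def mult.commute)
  obtain w where w: "[y' * w = 1] (mod m')" using cop cong_solve_coprime_nat by auto
  have "m' > 0" using assms m' by auto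
  \<comment> \<open>\<open>w\<close> inverts \<open>y'\<close> modulo \<open>m'\<close>, and
    \<open>(m' - 1) * c\<close> plays the role of -c in the natural numbers.\<close>
  have "[(a + c) * y = z] (mod m) \<longleftrightarrow> [a = z' * w + (m' - 1) * c] (mod m')" for a
  proof -
    have "[(a + c) * y = z] (mod m) \<longleftrightarrow> [(a + c) * y' = z'] (mod m')"
      unfolding y' m' z' cong_def mult.assoc[symmetric] using \<open>g > 0\<close>
      by (simp flip: mult_mod_left)
    also have "\<dots> \<longleftrightarrow> [(a + c) * y' = z' * w * y'] (mod m')"
      using cong_scalar_left[OF w, of z'] by (auto simp: cong_def ac_simps)
    also have "\<dots> \<longleftrightarrow> [a + c = z' * w] (mod m')"
      by (rule cong_mult_rcancel_nat[OF cop])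
    also have "\<dots> \<longleftrightarrow> [a + c + (m' - 1) * c = z' * w + (m' - 1) * c] (mod m')"
      by (rule cong_add_rcancel_nat[symmetric])
    also have "a + c + (m' - 1) * c = a + m' * c"
      using \<open>m' > 0\<close> by (cases m') auto
    also have "[a + m' * c = z' * w + (m' - 1) * c] (mod m')
        \<longleftrightarrow> [a = z' * w + (m' - 1) * c] (mod m')"
      by (simp add: cong_def)
    finally show ?thesis .
  qed
  then have "card {a. a < m \<and> [(a + c) * y = z] (mod m)}
      = card {a. a < m' * g \<and> [a = z' * w + (m' - 1) * c] (mod m')}"
    by (simp only: m'[symmetric])
  also have "\<dots> = g" by (rule card_less_mult_cong[OF \<open>m' > 0\<close>])
  finally show ?thesis unfolding g_def using True by (simp only: if_True)
qed

lemma card_gcd_eq_totient':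
  fixes d m :: nat
  assumes "m > 0" "d dvd m"
  shows "card {z. z < m \<and> gcd z m = d} = totient (m div d)"
proof -
  \<comment> \<open>0 and \<open>m\<close> trade places; both have gcd \<open>m\<close> with
    \<open>m\<close>.\<close>
  have "bij_betw (\<lambda>z. if z = 0 then m else z) {z. z < m \<and> gcd z m = d} {z\<in>{0<..m}. gcd z m = d}"
    by (rule bij_betw_byWitness[where f' = "\<lambda>z. if z = m then 0 else z"]) (use assms in auto)
  then show ?thesis using card_gcd_eq_totient[OF assms] by (simp add: bij_betw_same_card)
qed

lemma rad_dvd_rad:
  assumes "d dvd i" "i > 0"
  shows "rad d dvd rad i"
  unfolding rad_def using assms by (intro prod_dvd_prod_subset dvd_prime_factors) auto

text \<open>The hypothesis forces \<open>m\<close> and \<open>m div d\<close> to have the same prime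
  factors, so by Euler's product their totients have the same ratio as the numbers
  themselves.\<close>

lemma totient_div_mult:
  assumes "d * rad d dvd m" "m > 0"
  shows "d * totient (m div d) = totient m"
proof -
  obtain e where e: "m = d * e" "rad d dvd e"
    using assms by (metis dvd_def mult.assoc)
  then have pos: "d > 0" "e > 0" using assms by auto
  have "prime_factors d \<subseteq> prime_factors e"
  proof
    fix p assume "p \<in> prime_factors d"
    then have "p dvd rad d" unfolding rad_def by (intro dvd_prodI) auto
    with e pos \<open>p \<in> prime_factors d\<close> show "p \<in> prime_factors e"
      by (auto simp: in_prime_factors_iff intro: dvd_trans)
  qed
  then have "prime_factors m = prime_factors e"
    using pos e by (auto simp: prime_factors_product)
  then have "real (totient m) = real (d * totient e)"
    unfolding of_nat_mult totient_formula2 by (simp add: e)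
  then show ?thesis using e pos by (simp only: of_nat_eq_iff) simp
qed

section \<open>Distribution of digit products modulo \<open>m\<close>\<close>

definition digit_prod_count :: "nat \<Rightarrow> nat \<Rightarrow> nat \<Rightarrow> nat" where
  "digit_prod_count m t z = card {n. n < m ^ t \<and> [digit_prod m t n = z] (mod m)}"

lemma digit_prod_count_Suc_gcd:
  assumes "m > 0"
  shows "digit_prod_count m (Suc t) z =
    (\<Sum>n<m ^ t. let g = gcd (digit_prod m t n) m in if g dvd z then g else 0)"
  unfolding digit_prod_count_def power_Suc digit_prod.simps Let_def
  by (subst card_less_mult_mod_div[OF assms, where Q = "\<lambda>a b. [(a + 1) * digit_prod m t b = z] (mod m)"])
    (simp only: card_linear_cong[OF assms])

text \<open>Every \<open>g\<close> in the preceding sum divides \<open>m\<close>, so it divides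
  \<open>z\<close> iff it divides \<open>gcd z m\<close>. At least one digit is essential: the empty
  product 1 reaches only the class of 1, not every unit.\<close>

lemma digit_prod_count_gcd:
  assumes "m > 0"
  shows "digit_prod_count m (Suc t) (gcd z m) = digit_prod_count m (Suc t) z"
  by (simp add: digit_prod_count_Suc_gcd[OF assms])

text \<open>The residues \<open>z\<close> with \<open>gcd z m = d\<close> number
  \<open>totient (m div d)\<close>, and by \<open>digit_prod_count_gcd\<close> each is attained as
  often as \<open>d\<close> itself.\<close>

lemma card_gcd_digit_prod:
  assumes "m > 0" "d dvd m"
  shows "card {n. n < m ^ Suc t \<and> gcd (digit_prod m (Suc t) n) m = d}
           = totient (m div d) * digit_prod_count m (Suc t) d"
proof -
  let ?P = "digit_prod m (Suc t)"
  let ?S = "{n. n < m ^ Suc t \<and> gcd (?P n) m = d}" and ?T = "{z. z < m \<and> gcd z m = d}"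
  have gcd_mod: "gcd (w mod m) m = gcd w m" for w by (metis gcd.commute gcd_red_nat)
  have "(\<lambda>n. ?P n mod m) ` ?S \<subseteq> ?T"
    using assms(1) by (auto simp: gcd_mod simp del: digit_prod.simps)
  then have "card ?S = (\<Sum>z\<in>?T. card {n. n \<in> ?S \<and> ?P n mod m = z})"
    using sum.group[of ?S ?T "\<lambda>n. ?P n mod m" "\<lambda>_. 1::nat"] by simp
  also have "\<dots> = (\<Sum>z\<in>?T. digit_prod_count m (Suc t) d)"
  proof (rule sum.cong)
    fix z assume "z \<in> ?T"
    then have z: "z < m" "gcd z m = d" by auto
    have "n \<in> ?S \<and> ?P n mod m = z \<longleftrightarrow> n < m ^ Suc t \<and> [?P n = z] (mod m)" for n
      using gcd_mod[of "?P n"] z by (auto simp only: cong_def mod_less mem_Collect_eq)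
    then show "card {n. n \<in> ?S \<and> ?P n mod m = z} = digit_prod_count m (Suc t) d"
      using digit_prod_count_gcd[OF assms(1), of t z]
      by (simp only: z digit_prod_count_def)
  qed simp
  finally show ?thesis by (simp add: card_gcd_eq_totient'[OF assms])
qed

lemma digit_prod_count_Suc_Suc:
  assumes "m > 0" "i > 0" "i * rad i dvd m"
  shows "digit_prod_count m (Suc (Suc t)) i
           = totient m * (\<Sum>d | d dvd i. digit_prod_count m (Suc t) d)"
proof -
  let ?g = "\<lambda>n. gcd (digit_prod m (Suc t) n) m"
  let ?S = "{n. n < m ^ Suc t \<and> ?g n dvd i}"
  have "digit_prod_count m (Suc (Suc t)) i = (\<Sum>n<m ^ Suc t. if ?g n dvd i then ?g n else 0)"
    unfolding digit_prod_count_Suc_gcd[OF assms(1)] Let_def ..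
  also have "\<dots> = (\<Sum>n\<in>?S. ?g n)"
    by (subst sum.inter_filter[symmetric]) (auto intro!: sum.cong simp del: digit_prod.simps)
  also have "\<dots> = (\<Sum>d | d dvd i. \<Sum>n | n \<in> ?S \<and> ?g n = d. ?g n)"
    using assms(2) by (subst sum.group) auto
  also have "\<dots> = (\<Sum>d | d dvd i. totient m * digit_prod_count m (Suc t) d)"
  proof (rule sum.cong)
    fix d assume "d \<in> {d. d dvd i}"
    then have d: "d dvd i" by simp
    \<comment> \<open>Divisors of \<open>i\<close> inherit the divisibility hypothesis, which makes
      the weight \<open>d * totient (m div d)\<close> independent of \<open>d\<close>.\<close>
    have "d * rad d dvd m"
      using mult_dvd_mono[OF d rad_dvd_rad[OF d assms(2)]] assms(3) by (rule dvd_trans)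
    then have tot: "d * totient (m div d) = totient m" and "d dvd m"
      using totient_div_mult assms(1) by (auto intro: dvd_mult_left)
    have "{n. n \<in> ?S \<and> ?g n = d} = {n. n < m ^ Suc t \<and> ?g n = d}" using d by auto
    then have "(\<Sum>n | n \<in> ?S \<and> ?g n = d. ?g n) = d * card {n. n < m ^ Suc t \<and> ?g n = d}"
      by (simp del: digit_prod.simps)
    also have "\<dots> = totient m * digit_prod_count m (Suc t) d"
      unfolding card_gcd_digit_prod[OF assms(1) \<open>d dvd m\<close>] tot[symmetric] by (simp only: mult.assoc)
    finally show "(\<Sum>n | n \<in> ?S \<and> ?g n = d. ?g n) = totient m * digit_prod_count m (Suc t) d" .
  qed simp
  finally show ?thesis by (simp add: sum_distrib_left)
qed

section \<open>Ordered factorisations\<close>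

text \<open>The number of ordered factorisations of \<open>i\<close> into \<open>t + 1\<close> factors.\<close>

definition factorisation_count :: "nat \<Rightarrow> nat \<Rightarrow> nat" where
  "factorisation_count t i =
     (\<Prod>p\<in>prime_factors i. (multiplicity p i + t) choose multiplicity p i)"

lemma divisors_bij:
  fixes i :: nat
  assumes "i > 0"
  shows "bij_betw (\<lambda>f. \<Prod>p\<in>prime_factors i. p ^ f p)
           (\<Pi>\<^sub>E p\<in>prime_factors i. {..multiplicity p i}) {d. d dvd i}"
proof -
  let ?S = "prime_factors i"
  have mult: "multiplicity p (\<Prod>p\<in>?S. p ^ f p) = (if p \<in> ?S then f p else 0)"
    if "prime p" for p and f :: "nat \<Rightarrow> nat"
    using that by (intro multiplicity_prod_prime_powers) auto
  show ?thesis
  proof (rule bij_betw_byWitness[where f' = "\<lambda>d. \<lambda>p\<in>?S. multiplicity p d"], goal_cases)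
    case 1
    show ?case by (auto simp: fun_eq_iff mult in_prime_factors_imp_prime PiE_def extensional_def)
  next
    case 2
    show ?case
    proof
      fix d assume "d \<in> {d. d dvd i}"
      then have d: "d dvd i" "d > 0" using assms by (auto intro: Nat.gr0I)
      have "(\<Prod>p\<in>?S. p ^ (\<lambda>p\<in>?S. multiplicity p d) p) = (\<Prod>p\<in>?S. p ^ multiplicity p d)"
        by (intro prod.cong) auto
      also have "\<dots> = (\<Prod>p\<in>prime_factors d. p ^ multiplicity p d)"
        using d assms by (intro prod.mono_neutral_right dvd_prime_factors finite_set_mset)
          (auto simp: prime_factors_multiplicity)
      also have "\<dots> = d" using prime_factorization_nat[OF d(2)] by simp
      finally show "(\<Prod>p\<in>?S. p ^ (\<lambda>p\<in>?S. multiplicity p d) p) = d" .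
    qed
  next
    case 3
    show ?case
    proof safe
      fix f assume f: "f \<in> (\<Pi>\<^sub>E p\<in>?S. {..multiplicity p i})"
      then have "(\<Prod>p\<in>?S. p ^ f p) dvd (\<Prod>p\<in>?S. p ^ multiplicity p i)"
        by (intro prod_dvd_prod le_imp_power_dvd) auto
      then show "(\<Prod>p\<in>?S. p ^ f p) dvd i" using prime_factorization_nat[OF assms] by simp
    qed
  next
    case 4
    show ?case using assms by (auto intro!: dvd_imp_multiplicity_le)
  qed
qed

text \<open>Divisors are exponent vectors, so the sum of products factors into one binomial sum for
  each prime of \<open>i\<close>.\<close>

lemma sum_factorisation_count:
  assumes "i > 0"
  shows "(\<Sum>d | d dvd i. factorisation_count t d) = factorisation_count (Suc t) i"
proof -
  let ?S = "prime_factors i"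
  \<comment> \<open>Primes of \<open>i\<close> not dividing \<open>d\<close> contribute
    \<open>t choose 0 = 1\<close>, so one index set works for all \<open>d\<close>.\<close>
  have ext: "factorisation_count t d = (\<Prod>p\<in>?S. (multiplicity p d + t) choose multiplicity p d)"
    if "d dvd i" for d
    unfolding factorisation_count_def using that assms
    by (intro prod.mono_neutral_left dvd_prime_factors finite_set_mset) (auto simp: prime_factors_multiplicity)
  have "(\<Sum>d | d dvd i. factorisation_count t d)
      = (\<Sum>d | d dvd i. \<Prod>p\<in>?S. (multiplicity p d + t) choose multiplicity p d)"
    by (intro sum.cong) (auto simp: ext)
  also have "\<dots> = (\<Sum>f\<in>(\<Pi>\<^sub>E p\<in>?S. {..multiplicity p i}). \<Prod>p\<in>?S. (f p + t) choose f p)"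
    unfolding sum.reindex_bij_betw[OF divisors_bij[OF assms], symmetric]
  proof (intro sum.cong prod.cong refl)
    fix f p assume "p \<in> ?S"
    then have "multiplicity p (\<Prod>p\<in>?S. p ^ f p) = f p"
      by (subst multiplicity_prod_prime_powers) (auto simp: in_prime_factors_imp_prime)
    then show "(multiplicity p (\<Prod>p\<in>?S. p ^ f p) + t) choose multiplicity p (\<Prod>p\<in>?S. p ^ f p)
        = (f p + t) choose f p"
      by simp
  qed
  also have "\<dots> = (\<Prod>p\<in>?S. \<Sum>a\<le>multiplicity p i. (a + t) choose a)"
    by (subst prod_sum_PiE) auto
  \<comment> \<open>Hockey-stick identity at each prime.\<close>
  also have "\<dots> = factorisation_count (Suc t) i"
    unfolding factorisation_count_def
    using sum_choose_lower[of t] by (simp add: add.commute)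
  finally show ?thesis .
qed

section \<open>Solving the recursion and returning to partitions\<close>

lemma digit_prod_count_eq:
  assumes "m > 0" "i > 0" "i * rad i dvd m"
  shows "digit_prod_count m (Suc t) i = totient m ^ t * factorisation_count t i"
  using assms(2,3)
proof (induction t arbitrary: i)
  case 0
  \<comment> \<open>With a single digit the coefficient \<open>y\<close> is 1, so there is one
    solution, matching binomials \<open>a choose a\<close>.\<close>
  then show ?case using assms(1)
    by (simp add: digit_prod_count_Suc_gcd factorisation_count_def)
next
  case (Suc t)
  have "digit_prod_count m (Suc t) d = totient m ^ t * factorisation_count t d" if "d dvd i" for d
  proof (rule Suc.IH)
    show "d > 0" using that Suc.prems(1) by (auto intro: Nat.gr0I)
    show "d * rad d dvd m"
      using mult_dvd_mono[OF that rad_dvd_rad[OF that Suc.prems(1)]] Suc.prems(2) by (rule dvd_trans)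
  qed
  then have "(\<Sum>d | d dvd i. digit_prod_count m (Suc t) d)
      = totient m ^ t * factorisation_count (Suc t) i"
    by (simp add: sum_factorisation_count[OF Suc.prems(1), symmetric] sum_distrib_left)
  then show ?case by (simp add: digit_prod_count_Suc_Suc[OF assms(1) Suc.prems])
qed

lemma r_count_eq_digit_prod_count:
  assumes "m > 0"
  shows "r_count (int i) m (Suc t) = m * digit_prod_count m t i"
proof -
  have iff: "[int (part_count (power_seq m) n (Suc t)) = int i] (mod int m)
      \<longleftrightarrow> [digit_prod m t (n div m) = i] (mod m)" for n
    unfolding cong_int_iff using part_count_cong_digit_prod[OF assms, of n t] by (simp add: cong_def)
  have "r_count (int i) m (Suc t)
      = card {n. n < m * m ^ t \<and> [digit_prod m t (n div m) = i] (mod m)}"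
    unfolding r_count_def iff by simp
  also have "\<dots> = (\<Sum>b<m ^ t. card {a. a < m \<and> [digit_prod m t b = i] (mod m)})"
    by (rule card_less_mult_mod_div[OF assms])
  also have "\<dots> = (\<Sum>b<m ^ t. if [digit_prod m t b = i] (mod m) then m else 0)"
    by (intro sum.cong) auto
  also have "\<dots> = m * digit_prod_count m t i"
    unfolding digit_prod_count_def
    by (subst sum.inter_filter[symmetric]) auto
  finally show ?thesis .
qed

theorem theorem6p15:
  fixes i k m s :: nat and p \<alpha> :: "nat \<Rightarrow> nat"
  assumes "i > 0" and "m > 0" and "k \<ge> 2"
    and "i * rad i dvd m"
    and "s > 0"
    and "\<And>j. j \<in> {1..s} \<Longrightarrow> prime (p j)"
    and "inj_on p {1..s}"
    and "\<And>j. j \<in> {1..s} \<Longrightarrow> \<alpha> j > 0"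
    and "i = (\<Prod>j = 1..s. p j ^ \<alpha> j)"
  shows "r_count (int i) m k =
    m * totient m ^ (k - 2) * (\<Prod>j = 1..s. (\<alpha> j + k - 2) choose \<alpha> j)"
proof -
  define t where "t = k - 2"
  have k: "k = Suc (Suc t)" using assms(3) by (simp add: t_def)
  \<comment> \<open>Exponents are re-indexed by the primes themselves, so that they can be compared
    with \<open>multiplicity\<close>.\<close>
  let ?\<beta> = "\<lambda>q. \<alpha> (the_inv_into {1..s} p q)"
  have \<beta>: "?\<beta> (p j) = \<alpha> j" if "j \<in> {1..s}" for j
    using that assms(7) by (simp add: the_inv_into_f_f)
  have "i = (\<Prod>q\<in>p ` {1..s}. q ^ ?\<beta> q)"
    unfolding prod.reindex[OF assms(7)] assms(9) using \<beta> by (intro prod.cong) auto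
  moreover have "multiplicity q (\<Prod>q\<in>p ` {1..s}. q ^ ?\<beta> q)
      = (if q \<in> p ` {1..s} then ?\<beta> q else 0)" if "prime q" for q
    using that assms(6) by (intro multiplicity_prod_prime_powers) auto
  ultimately have mult: "multiplicity q i = (if q \<in> p ` {1..s} then ?\<beta> q else 0)"
    if "prime q" for q
    using that by simp
  \<comment> \<open>Positive exponents ensure that every \<open>p j\<close> really divides
    \<open>i\<close>.\<close>
  have "prime_factors i = p ` {1..s}"
    unfolding prime_factors_multiplicity using assms(6,8) \<beta> by (auto simp: mult split: if_splits)
  then have "factorisation_count t i = (\<Prod>j = 1..s. (\<alpha> j + t) choose \<alpha> j)"
    unfolding factorisation_count_def \<open>prime_factors i = p ` {1..s}\<close> prod.reindex[OF assms(7)]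
    using assms(6) \<beta> by (intro prod.cong) (auto simp: mult)
  then show ?thesis
    unfolding k r_count_eq_digit_prod_count[OF assms(2)] digit_prod_count_eq[OF assms(2,1,4)]
    by simp
qed

end
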